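(* Let $N\ge 1$ and let $\mathbf{A},\mathbf{B},\mathbf{C}$ be $N\times N$ complex matrices with $\mathbf{A}$ invertible. Let $$\mathbf{M}(\lambda)=\begin{bmatrix}\lambda\mathbf{1} & -\mathbf{1}\\ \mathbf{A}^{-1}\mathbf{C} & \lambda\mathbf{1}+\mathbf{A}^{-1}\mathbf{B}\end{bmatrix},\qquad \mathbf{S}(\lambda)=\lambda^{2}\mathbf{1}+\lambda\mathbf{A}^{-1}\mathbf{B}+\mathbf{A}^{-1}\mathbf{C}.$$ Let $\mathbf{V}_1,\mathbf{Q}$ be $N\times N$ matrices, let $\lambda_1,\dots,\lambda_N,\rho_1,\dots,\rho_N$ be scalars, and put $\mathbf{D}_1=\mathrm{diag}(\lambda_1,\dots,\lambda_N)$, $\mathbf{D}_2=\mathrm{diag}(\rho_1,\dots,\rho_N)$. The following are equivalent. (i) $\mathbf{V}_1$ is invertible and $\mathbf{M}(\lambda)$ is diagonalizable with eigenpairs $$\Bigl(\lambda_i,\ \mathrm{col}_i\begin{bmatrix}\mathbf{V}_1\\ \mathbf{V}_1\mathbf{D}_1\end{bmatrix}\Bigr)\quad\text{and}\quad\Bigl(\rho_i,\ \mathrm{col}_i\begin{bmatrix}\mathbf{V}_1\mathbf{Q}\\ \mathbf{V}_1\mathbf{Q}\mathbf{D}_2\end{bmatrix}\Bigr),\qquad i=1,\dots,N.$$ (ii) The second-order pencil satisfies $$\det\mathbf{S}(\lambda)=(\lambda-\rho_1)\cdots(\lambda-\rho_N)(\lambda-\lambda_1)\cdots(\lambda-\lambda_N)$$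 for all $\lambda$, it has eigenpairs $$(\lambda_i,\ \mathrm{col}_i(\mathbf{V}_1))\quad\text{and}\quad(\rho_i,\ \mathrm{col}_i(\mathbf{V}_1\mathbf{Q})),\qquad i=1,\dots,N,$$ and $\det\mathbf{V}_1\neq0$ and $\det(\mathbf{D}_1\mathbf{Q}-\mathbf{Q}\mathbf{D}_2)\neq0$. Moreover, (i) implies $\det\mathbf{M}(\lambda)=(\lambda-\rho_1)\cdots(\lambda-\rho_N)(\lambda-\lambda_1)\cdots(\lambda-\lambda_N)$ for all $\lambda$.
   Context: The matrices arise from a constant-coefficient second-order system $(\mathbf{A}\partial_t^2+\mathbf{B}^i\partial_i\partial_t+\mathbf{C}^{ij}\partial_i\partial_j)\phi=0$ with $\mathbf{A}$ invertible, by fixing a unit wave covector $\hat k_i$ and putting $\mathbf{B}=\mathbf{B}^i\hat k_i$, $\mathbf{C}=\mathbf{C}^{ij}\hat k_i\hat k_j$. Here $\mathbf{1}$ is the $N\times N$ identity, $\lambda\in\mathbb{C}$ is a parameter, and $\mathrm{col}_i[R]$ is the $i$-th column of a matrix $R$. A pair $(\sigma,u)$ with $u\ne0$ is an eigenpair of $\mathbf{M}(\lambda)$ if $\mathbf{M}(\sigma)u=0$; similarly $(\sigma,v)$ with $v\neq0$ is an eigenpair of $\mathbf{S}(\lambda)$ if $\mathbf{S}(\sigma)v=0$. $\mathbf{M}(\lambda)$ is called diagonalizable if there are an invertible $2N\times 2N$ matrix $\mathbf{P}$ and a diagonal $2N\times 2N$ matrix $\mathbf{D}$, both independent of $\lambda$,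 with $\mathbf{M}(\lambda)=\mathbf{P}(\lambda\mathbf{1}_{2N}-\mathbf{D})\mathbf{P}^{-1}$ for all $\lambda$. It is diagonalizable with a given list of $2N$ eigenpairs if moreover $\mathbf{P}$ can be taken to have the listed vectors as columns and $\mathbf{D}$ the corresponding eigenvalues as diagonal entries, i.e. the listed vectors are eigenvectors for the listed eigenvalues and form a basis of $\mathbb{C}^{2N}$. *)

theory Defs
  imports Complex_Main
    "Jordan_Normal_Form.Matrix"
    "Jordan_Normal_Form.Determinant"
    "Jordan_Normal_Form.Gauss_Jordan_Elimination"
begin

abbreviation mat_inv :: "'a :: field mat \<Rightarrow> 'a mat"
  where "mat_inv A \<equiv> the (mat_inverse A)"

lemma mat_inv_invertible:
  fixes A :: "'a :: field mat"
  assumes A: "A \<in> carrier_mat n n" and inv: "invertible_mat A"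
  shows "mat_inv A \<in> carrier_mat n n" "A * mat_inv A = 1\<^sub>m n" "mat_inv A * A = 1\<^sub>m n"
proof -
  obtain B where B: "A * B = 1\<^sub>m n" "B * A = 1\<^sub>m (dim_row B)"
    using A inv unfolding invertible_mat_def inverts_mat_def by auto
  have "dim_col B = n" using arg_cong[OF B(1), of dim_col] by simp
  moreover have "dim_row B = n" using arg_cong[OF B(2), of dim_col] A by simp
  ultimately have "B \<in> carrier_mat n n" by auto
  with A B have "A \<in> Units (ring_mat TYPE('a) n ())"
    by (auto simp: Units_def ring_mat_simps)
  with mat_inverse(1)[OF A, where b = "()"] obtain C where C: "mat_inverse A = Some C"
    by (cases "mat_inverse A") auto
  from mat_inverse(2)[OF A C] C
  show "mat_inv A \<in> carrier_mat n n" "A * mat_inv A = 1\<^sub>m n" "mat_inv A * A = 1\<^sub>m n" by auto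
qed

text \<open>A matrix pencil is a matrix-valued function of the complex parameter; its
  eigenpairs are those of a nonlinear eigenvalue problem, so \<open>eigenvector\<close> does not apply.\<close>

definition pencil_eigenpair ::
  "nat \<Rightarrow> (complex \<Rightarrow> complex mat) \<Rightarrow> complex \<times> complex vec \<Rightarrow> bool"
  where "pencil_eigenpair n F p \<longleftrightarrow>
    snd p \<in> carrier_vec n \<and> snd p \<noteq> 0\<^sub>v n \<and> F (fst p) *\<^sub>v snd p = 0\<^sub>v n"

definition pencil_diagonalization ::
  "nat \<Rightarrow> (complex \<Rightarrow> complex mat) \<Rightarrow> complex mat \<Rightarrow> complex mat \<Rightarrow> bool"
  where "pencil_diagonalization n F P D \<longleftrightarrow>
    P \<in> carrier_mat n n \<and> invertible_mat P \<and>
    D \<in> carrier_mat n n \<and> diagonal_mat D \<and>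
    (\<forall>x. F x = P * (x \<cdot>\<^sub>m 1\<^sub>m n - D) * mat_inv P)"

definition pencil_diagonalizable_with ::
  "nat \<Rightarrow> (complex \<Rightarrow> complex mat) \<Rightarrow> (complex \<times> complex vec) list \<Rightarrow> bool"
  where "pencil_diagonalizable_with n F ps \<longleftrightarrow> length ps = n \<and>
    (\<exists>P D. pencil_diagonalization n F P D \<and>
      (\<forall>i<n. D $$ (i, i) = fst (ps ! i) \<and> col P i = snd (ps ! i)))"

lemma pencil_diagonalizable_with_eigenpair:
  assumes "pencil_diagonalizable_with n F ps" and p: "p \<in> set ps"
  shows "pencil_eigenpair n F p"
proof -
  obtain P D where len: "length ps = n"
    and PD: "P \<in> carrier_mat n n" "invertible_mat P" "D \<in> carrier_mat n n" "diagonal_mat D"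
    and F: "\<And>x. F x = P * (x \<cdot>\<^sub>m 1\<^sub>m n - D) * mat_inv P"
    and ev: "\<And>i. i < n \<Longrightarrow> D $$ (i, i) = fst (ps ! i)" "\<And>i. i < n \<Longrightarrow> col P i = snd (ps ! i)"
    using assms(1) unfolding pencil_diagonalizable_with_def pencil_diagonalization_def by blast
  obtain i where i: "i < n" "p = ps ! i" using p len by (auto simp: in_set_conv_nth)
  let ?I = "mat_inv P" and ?E = "fst p \<cdot>\<^sub>m 1\<^sub>m n - D"
  note inv = mat_inv_invertible[OF PD(1,2)]
  have unit: "X *\<^sub>v unit_vec n i = col X i" if "X \<in> carrier_mat n n" for X :: "complex mat"
    using that i(1) by (intro eq_vecI) auto
  have u: "snd p = P *\<^sub>v unit_vec n i" using ev(2)[OF i(1)] i(2) unit[OF PD(1)] by simp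
  have carr: "snd p \<in> carrier_vec n" using PD(1) u by simp
  have E: "?E \<in> carrier_mat n n" using PD(3) by auto
  have invu: "?I *\<^sub>v snd p = unit_vec n i"
    unfolding u using assoc_mult_mat_vec[OF inv(1) PD(1) unit_vec_carrier] inv(3) by simp
  have "?E *\<^sub>v unit_vec n i = col ?E i"
    by (rule unit[OF E])
  also have "\<dots> = 0\<^sub>v n"
    using PD(3,4) i ev(1)[OF i(1)]
    by (intro eq_vecI) (auto simp: diagonal_mat_def)
  finally have E0: "?E *\<^sub>v unit_vec n i = 0\<^sub>v n" .
  have "F (fst p) *\<^sub>v snd p = (P * ?E) *\<^sub>v (?I *\<^sub>v snd p)"
    unfolding F using assoc_mult_mat_vec[OF mult_carrier_mat[OF PD(1) E] inv(1) carr] .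
  also have "\<dots> = P *\<^sub>v (?E *\<^sub>v unit_vec n i)"
    unfolding invu using assoc_mult_mat_vec[OF PD(1) E unit_vec_carrier] .
  also have "\<dots> = 0\<^sub>v n" unfolding E0 using PD(1) by (intro eq_vecI) auto
  finally have ker: "F (fst p) *\<^sub>v snd p = 0\<^sub>v n" .
  have "snd p \<noteq> 0\<^sub>v n"
  proof
    assume "snd p = 0\<^sub>v n"
    with invu have "unit_vec n i = ?I *\<^sub>v 0\<^sub>v n" by simp
    also have "\<dots> = 0\<^sub>v n" using inv(1) by (intro eq_vecI) auto
    finally have "unit_vec n i = (0\<^sub>v n :: complex vec)" .
    then show False using i(1) by simp
  qed
  with carr ker show ?thesis by (simp add: pencil_eigenpair_def)
qed

end

theory Submission
  imports Defs
begin

text \<open>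
  The block pencil \<open>M\<close> is the companion linearization of the monic quadratic pencil \<open>S\<close>: reading
  the second half of a vector as \<open>x\<close> times the first half, the first block row of \<open>M x\<close> is
  satisfied identically and the second one becomes \<open>S x u = 0\<close>. Hence \<open>u\<close> is an eigenvector of \<open>S\<close>
  at \<open>x\<close> iff the stacked vector \<open>(u, x u)\<close> is one of \<open>M\<close> (\<open>companion_eigenpair_iff\<close>), and block
  elimination gives \<open>det (M x) = det (S x)\<close> (\<open>det_companion_pencil\<close>).

  Since \<open>M x = x I - K\<close> for a constant matrix \<open>K\<close>, diagonalizing \<open>M\<close> with a given list of pairs
  is the same as asking that all of them are eigenpairs and that their vectors are the columns of a
  matrix \<open>P\<close> with nonzero determinant (\<open>pencil_diagonalizable_with_iff_eigenbasis\<close>). Here \<open>P\<close> has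
  the blocks \<open>V1\<close>, \<open>V1 Q\<close> above \<open>V1 D1\<close>, \<open>V1 Q D2\<close>; pulling out \<open>V1\<close> on the left and eliminating
  below the identity block yields
  \<open>det P = det V1 * det V1 * det (Q D2 - D1 Q)\<close> (\<open>det_stacked_eigenvectors\<close>). So the
  conditions on \<open>det V1\<close> and \<open>det (D1 Q - Q D2)\<close> say exactly that the stacked vectors form a basis.

  The factorizations of \<open>det (S x)\<close> and \<open>det (M x)\<close> come from the diagonalization, which makes the
  common determinant the product of the factors \<open>x - \<mu>\<close> over the listed eigenvalues \<open>\<mu>\<close>
  (\<open>pencil_diagonalizable_with_det\<close>).
\<close>

section \<open>Invertibility and eigenvectors\<close>

lemma invertible_mat_iff_det:
  fixes A :: "'a :: field mat"
  assumes A: "A \<in> carrier_mat n n"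
  shows "invertible_mat A \<longleftrightarrow> det A \<noteq> 0"
proof
  assume "invertible_mat A"
  from mat_inv_invertible[OF A this] have "det A * det (mat_inv A) = 1"
    using det_mult[OF A, of "mat_inv A"] by simp
  then show "det A \<noteq> 0" by auto
next
  assume "det A \<noteq> 0"
  from det_non_zero_imp_unit[OF A this, of "()"]
  obtain X where "X \<in> carrier_mat n n" "X * A = 1\<^sub>m n" "A * X = 1\<^sub>m n"
    by (auto simp: Units_def ring_mat_simps)
  with A show "invertible_mat A"
    unfolding invertible_mat_def inverts_mat_def by (auto intro!: exI[of _ X])
qed

lemma smult_one_mult:
  fixes X :: "'a :: comm_ring_1 mat"
  assumes "X \<in> carrier_mat n m"
  shows "(x \<cdot>\<^sub>m 1\<^sub>m n) * X = x \<cdot>\<^sub>m X" "X * (x \<cdot>\<^sub>m 1\<^sub>m m) = x \<cdot>\<^sub>m X"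
  using assms
  by (simp_all add: mult_smult_assoc_mat[OF one_carrier_mat assms]
      mult_smult_distrib[OF assms one_carrier_mat])

lemma smult_mult_mat_vec:
  fixes X :: "'a :: comm_ring_1 mat"
  assumes "X \<in> carrier_mat n m" "v \<in> carrier_vec m"
  shows "(x \<cdot>\<^sub>m X) *\<^sub>v v = x \<cdot>\<^sub>v (X *\<^sub>v v)" "X *\<^sub>v (x \<cdot>\<^sub>v v) = x \<cdot>\<^sub>v (X *\<^sub>v v)"
  using assms by (auto intro!: eq_vecI)

lemma diagonal_mat_conv_mat_diag:
  assumes "D \<in> carrier_mat n n" "diagonal_mat D" "\<And>i. i < n \<Longrightarrow> D $$ (i, i) = f i"
  shows "D = mat_diag n f"
  using assms by (intro eq_matI) (auto simp: mat_diag_def diagonal_mat_def)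

lemma det_smult_one_minus_mat_diag:
  "det (x \<cdot>\<^sub>m 1\<^sub>m n - mat_diag n f) = (\<Prod>i<n. x - f i :: 'a :: comm_ring_1)"
proof -
  have "x \<cdot>\<^sub>m 1\<^sub>m n - mat_diag n f = mat_diag n (\<lambda>i. x - f i)"
    by (intro eq_matI) (auto simp: mat_diag_def)
  moreover have "det (mat_diag n g) = (\<Prod>i<n. g i)" for g :: "nat \<Rightarrow> 'a"
    by (subst det_upper_triangular[of _ n])
      (auto simp: mat_diag_def diag_mat_def prod.list_conv_set_nth lessThan_atLeast0)
  ultimately show ?thesis by simp
qed

text \<open>The determinants of \<open>P\<close> and of its inverse cancel, which leaves that of a diagonal matrix.\<close>

lemma pencil_diagonalization_det:
  assumes "pencil_diagonalization n F P D"
  shows "det (F x) = (\<Prod>i<n. x - D $$ (i, i))"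
proof -
  note PD = assms[unfolded pencil_diagonalization_def]
  have P: "P \<in> carrier_mat n n" and D: "D \<in> carrier_mat n n" using PD by auto
  let ?E = "x \<cdot>\<^sub>m 1\<^sub>m n - D"
  have E: "?E \<in> carrier_mat n n" using D by auto
  have inv: "mat_inv P \<in> carrier_mat n n" "P * mat_inv P = 1\<^sub>m n"
    using mat_inv_invertible[OF P] PD by auto
  have "det (F x) = det P * det ?E * det (mat_inv P)"
    using PD P E inv(1) by (simp add: det_mult[of _ n])
  also have "\<dots> = det (P * mat_inv P) * det ?E"
    using det_mult[OF P inv(1)] by simp
  also have "\<dots> = det ?E" using inv(2) by simp
  also have "D = mat_diag n (\<lambda>i. D $$ (i, i))"
    using PD by (intro diagonal_mat_conv_mat_diag) auto
  then have "det ?E = (\<Prod>i<n. x - D $$ (i, i))"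
    using det_smult_one_minus_mat_diag[of x n "\<lambda>i. D $$ (i, i)"] by simp
  finally show ?thesis .
qed

lemma pencil_diagonalizable_with_det:
  assumes "pencil_diagonalizable_with n F ps"
  shows "det (F x) = (\<Prod>i<n. x - fst (ps ! i))"
proof -
  from assms obtain P D where "pencil_diagonalization n F P D"
    and D: "\<And>i. i < n \<Longrightarrow> D $$ (i, i) = fst (ps ! i)"
    unfolding pencil_diagonalizable_with_def by blast
  from pencil_diagonalization_det[OF this(1)] D show ?thesis by simp
qed

text \<open>
  For a pencil \<open>x I - K\<close>, being an eigenpair is an ordinary eigenvalue equation for \<open>K\<close>. Collecting
  these equations column by column gives \<open>K P = P D\<close>, a single identity without \<open>x\<close>, which
  diagonalizes the pencil for all \<open>x\<close> simultaneously once \<open>P\<close> can be inverted. The form \<open>x I - K\<close>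
  is essential here: an eigenpair by itself constrains a pencil at one value of \<open>x\<close> only.
\<close>

lemma pencil_diagonalizable_with_iff_eigenbasis:
  assumes K: "K \<in> carrier_mat n n" and F: "\<And>x. F x = x \<cdot>\<^sub>m 1\<^sub>m n - K"
    and len: "length ps = n"
  shows "pencil_diagonalizable_with n F ps \<longleftrightarrow>
    (\<forall>p \<in> set ps. pencil_eigenpair n F p) \<and> det (mat_of_cols n (map snd ps)) \<noteq> 0"
proof (intro iffI conjI)
  assume diag: "pencil_diagonalizable_with n F ps"
  then show "\<forall>p \<in> set ps. pencil_eigenpair n F p"
    using pencil_diagonalizable_with_eigenpair by blast
  from diag obtain P D where P: "P \<in> carrier_mat n n" "invertible_mat P"
    and "\<And>i. i < n \<Longrightarrow> col P i = snd (ps ! i)"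
    unfolding pencil_diagonalizable_with_def pencil_diagonalization_def by blast
  then have "map snd ps = cols P"
    using len by (intro nth_equalityI) auto
  then have "mat_of_cols n (map snd ps) = P" using P by auto
  with P show "det (mat_of_cols n (map snd ps)) \<noteq> 0"
    using invertible_mat_iff_det by auto
next
  let ?P = "mat_of_cols n (map snd ps)" and ?D = "mat_diag n (\<lambda>i. fst (ps ! i))"
  assume R: "(\<forall>p \<in> set ps. pencil_eigenpair n F p) \<and> det ?P \<noteq> 0"
  have P: "?P \<in> carrier_mat n n" using len by auto
  have D: "?D \<in> carrier_mat n n" by simp
  have invP: "invertible_mat ?P" using R invertible_mat_iff_det[OF P] by simp
  note inv = mat_inv_invertible[OF P invP]
  have colP: "col ?P i = snd (ps ! i)" and v: "snd (ps ! i) \<in> carrier_vec n"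
    and ker: "F (fst (ps ! i)) *\<^sub>v snd (ps ! i) = 0\<^sub>v n" if "i < n" for i
  proof -
    have "pencil_eigenpair n F (ps ! i)" using R that len by auto
    then show v: "snd (ps ! i) \<in> carrier_vec n" and "F (fst (ps ! i)) *\<^sub>v snd (ps ! i) = 0\<^sub>v n"
      by (auto simp: pencil_eigenpair_def)
    from v show "col ?P i = snd (ps ! i)" using that len by auto
  qed
  have KP: "K * ?P = ?P * ?D"
  proof (rule eq_matI)
    fix j i assume "j < dim_row (?P * ?D)" "i < dim_col (?P * ?D)"
    then have ji: "j < n" "i < n" using P D len by auto
    let ?v = "snd (ps ! i)"
    have "0 = (F (fst (ps ! i)) *\<^sub>v ?v) $ j" using ker ji by simp
    also have "F (fst (ps ! i)) *\<^sub>v ?v = (fst (ps ! i) \<cdot>\<^sub>m 1\<^sub>m n) *\<^sub>v ?v - K *\<^sub>v ?v"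
      unfolding F by (rule minus_mult_distrib_mat_vec) (use K v[OF ji(2)] in auto)
    also have "(fst (ps ! i) \<cdot>\<^sub>m 1\<^sub>m n) *\<^sub>v ?v = fst (ps ! i) \<cdot>\<^sub>v ?v"
      using v[OF ji(2)] by (simp add: smult_mult_mat_vec[of _ n n])
    finally have "(K *\<^sub>v ?v) $ j = fst (ps ! i) * ?v $ j" using ji K v[OF ji(2)] by (simp add: carrier_vecD)
    then have "row K j \<bullet> ?v = ?v $ j * fst (ps ! i)" using ji K by simp
    moreover have "?P $$ (j, i) = ?v $ j" using ji len by (simp add: mat_of_cols_index)
    ultimately show "(K * ?P) $$ (j, i) = (?P * ?D) $$ (j, i)"
      using ji K len colP[OF ji(2)] unfolding mat_diag_mult_right[OF P] by simp
  qed (use K P len in \<open>auto simp: mat_diag_def\<close>)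
  have "F x = ?P * (x \<cdot>\<^sub>m 1\<^sub>m n - ?D) * mat_inv ?P" for x
  proof -
    have E: "x \<cdot>\<^sub>m 1\<^sub>m n - ?D \<in> carrier_mat n n" by (rule minus_carrier_mat) simp
    have "?P * (x \<cdot>\<^sub>m 1\<^sub>m n - ?D) = ?P * (x \<cdot>\<^sub>m 1\<^sub>m n) - ?P * ?D"
      by (rule mult_minus_distrib_mat[OF P _ D]) simp
    also have "\<dots> = (x \<cdot>\<^sub>m 1\<^sub>m n) * ?P - K * ?P"
      using smult_one_mult[OF P] KP by simp
    also have "\<dots> = F x * ?P"
      unfolding F by (rule minus_mult_distrib_mat[OF _ K P, symmetric]) simp
    finally have "?P * (x \<cdot>\<^sub>m 1\<^sub>m n - ?D) * mat_inv ?P = F x * ?P * mat_inv ?P" by simp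
    also have "\<dots> = F x * (?P * mat_inv ?P)"
      by (rule assoc_mult_mat[OF _ P inv(1)]) (use K in \<open>auto simp: F\<close>)
    also have "\<dots> = F x" unfolding inv(2) by (rule right_mult_one_mat) (use K in \<open>auto simp: F\<close>)
    finally show ?thesis by simp
  qed
  moreover have "diagonal_mat ?D" by (auto simp: diagonal_mat_def mat_diag_def)
  ultimately have "pencil_diagonalization n F ?P ?D"
    unfolding pencil_diagonalization_def using P D invP by blast
  moreover have "?D $$ (i, i) = fst (ps ! i)" if "i < n" for i
    using that by (simp add: mat_diag_def)
  ultimately show "pencil_diagonalizable_with n F ps"
    unfolding pencil_diagonalizable_with_def using len colP by blast
qed

section \<open>Linearization of a monic quadratic pencil\<close>

definition quadratic_pencil :: "nat \<Rightarrow> 'a :: comm_ring_1 mat \<Rightarrow> 'a mat \<Rightarrow> 'a \<Rightarrow> 'a mat"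
  where "quadratic_pencil n B C x = x^2 \<cdot>\<^sub>m 1\<^sub>m n + x \<cdot>\<^sub>m B + C"

definition companion_pencil :: "nat \<Rightarrow> 'a :: comm_ring_1 mat \<Rightarrow> 'a mat \<Rightarrow> 'a \<Rightarrow> 'a mat"
  where "companion_pencil n B C x =
    four_block_mat (x \<cdot>\<^sub>m 1\<^sub>m n) (- 1\<^sub>m n) C (x \<cdot>\<^sub>m 1\<^sub>m n + B)"

lemma companion_pencil_monic:
  assumes "B \<in> carrier_mat n n" "C \<in> carrier_mat n n"
  shows "companion_pencil n B C x =
    x \<cdot>\<^sub>m 1\<^sub>m (n + n) - four_block_mat (0\<^sub>m n n) (1\<^sub>m n) (- C) (- B)"
  using assms by (intro eq_matI) (auto simp: companion_pencil_def)

text \<open>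
  Column operations do the elimination. The factor \<open>T\<close> below, with blocks \<open>0\<close>, \<open>I\<close> above \<open>- I\<close>,
  \<open>x I\<close>, adds \<open>x\<close> times the second block column to the first one, which clears the top left block
  and turns the bottom left one into \<open>C + x (x I + B)\<close>, the quadratic pencil; it then exchanges
  the block columns with a sign so that \<open>det T = 1\<close>. The product is lower block triangular with
  the identity in the top left corner.
\<close>

lemma det_companion_pencil:
  fixes B C :: "'a :: idom mat"
  assumes B: "B \<in> carrier_mat n n" and C: "C \<in> carrier_mat n n"
  shows "det (companion_pencil n B C x) = det (quadratic_pencil n B C x)"
proof -
  let ?I = "1\<^sub>m n :: 'a mat" and ?O = "0\<^sub>m n n :: 'a mat"
  let ?E = "x \<cdot>\<^sub>m ?I + B"
  let ?T = "four_block_mat ?O ?I (- ?I) (x \<cdot>\<^sub>m ?I)"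
  have E: "?E \<in> carrier_mat n n" using B by auto
  have "companion_pencil n B C x * ?T = four_block_mat
      (x \<cdot>\<^sub>m ?I * ?O + - ?I * - ?I) (x \<cdot>\<^sub>m ?I * ?I + - ?I * (x \<cdot>\<^sub>m ?I))
      (C * ?O + ?E * - ?I) (C * ?I + ?E * (x \<cdot>\<^sub>m ?I))"
    unfolding companion_pencil_def
    by (rule mult_four_block_mat[of _ n n _ n _ n]) (use B C in auto)
  also have "x \<cdot>\<^sub>m ?I * ?O + - ?I * - ?I = ?I"
    by (simp add: smult_one_mult)
  also have "x \<cdot>\<^sub>m ?I * ?I + - ?I * (x \<cdot>\<^sub>m ?I) = ?O"
    by (simp add: smult_one_mult) (intro eq_matI; auto)
  also have "C * ?I + ?E * (x \<cdot>\<^sub>m ?I) = quadratic_pencil n B C x"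
    unfolding smult_one_mult(2)[OF E] quadratic_pencil_def using B C
    by (intro eq_matI) (auto simp: algebra_simps power2_eq_square)
  finally have "det (companion_pencil n B C x * ?T) =
      det (four_block_mat ?I ?O (C * ?O + ?E * - ?I) (quadratic_pencil n B C x))"
    by simp
  also have "\<dots> = det (quadratic_pencil n B C x)"
    by (subst det_four_block_mat_upper_right_zero[of _ n _ n])
      (use B C in \<open>auto simp: quadratic_pencil_def\<close>)
  finally have "det (companion_pencil n B C x * ?T) = det (quadratic_pencil n B C x)" .
  moreover have "det ?T = 1"
  proof -
    have "det ?T = det (?O * (x \<cdot>\<^sub>m ?I) - ?I * - ?I)"
      by (rule det_four_block_mat) (auto simp: smult_one_mult)
    also have "?O * (x \<cdot>\<^sub>m ?I) - ?I * - ?I = ?I"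
      by (simp add: smult_one_mult) (intro eq_matI; auto)
    finally show ?thesis by simp
  qed
  moreover have "det (companion_pencil n B C x * ?T) = det (companion_pencil n B C x) * det ?T"
    by (rule det_mult[of _ "n + n"]) (use B C in \<open>auto simp: companion_pencil_def\<close>)
  ultimately show ?thesis by simp
qed

lemma companion_pencil_mult_stacked:
  fixes B C :: "'a :: comm_ring_1 mat"
  assumes B: "B \<in> carrier_mat n n" and C: "C \<in> carrier_mat n n" and u: "u \<in> carrier_vec n"
  shows "companion_pencil n B C x *\<^sub>v (u @\<^sub>v x \<cdot>\<^sub>v u) = 0\<^sub>v n @\<^sub>v (quadratic_pencil n B C x *\<^sub>v u)"
proof -
  let ?I = "1\<^sub>m n :: 'a mat"
  have "companion_pencil n B C x *\<^sub>v (u @\<^sub>v x \<cdot>\<^sub>v u) =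
     ((x \<cdot>\<^sub>m ?I) *\<^sub>v u + - ?I *\<^sub>v (x \<cdot>\<^sub>v u)) @\<^sub>v (C *\<^sub>v u + (x \<cdot>\<^sub>m ?I + B) *\<^sub>v (x \<cdot>\<^sub>v u))"
    unfolding companion_pencil_def
    by (rule four_block_mat_mult_vec[of _ n n _ n _ n]) (use B C u in auto)
  also have "(x \<cdot>\<^sub>m ?I) *\<^sub>v u + - ?I *\<^sub>v (x \<cdot>\<^sub>v u) = 0\<^sub>v n"
    using u by (intro eq_vecI) (auto simp: smult_mult_mat_vec[of _ n n])
  also have "C *\<^sub>v u + (x \<cdot>\<^sub>m ?I + B) *\<^sub>v (x \<cdot>\<^sub>v u) = quadratic_pencil n B C x *\<^sub>v u"
  proof -
    have "quadratic_pencil n B C x *\<^sub>v u =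
        (x^2 \<cdot>\<^sub>m ?I) *\<^sub>v u + (x \<cdot>\<^sub>m B) *\<^sub>v u + C *\<^sub>v u"
      unfolding quadratic_pencil_def using B C u
      by (simp add: add_mult_distrib_mat_vec[of _ n n])
    moreover have "(x \<cdot>\<^sub>m ?I + B) *\<^sub>v (x \<cdot>\<^sub>v u) = (x^2 \<cdot>\<^sub>m ?I) *\<^sub>v u + (x \<cdot>\<^sub>m B) *\<^sub>v u"
      using B u
      by (simp add: add_mult_distrib_mat_vec[of _ n n] smult_mult_mat_vec[of _ n n]
          smult_smult_assoc smult_add_distrib_vec[of _ n] power2_eq_square)
    moreover have "C *\<^sub>v u + w = w + C *\<^sub>v u" if "w \<in> carrier_vec n" for w
      using C u that by (intro comm_add_vec[of _ n]) auto
    moreover have "(x^2 \<cdot>\<^sub>m ?I) *\<^sub>v u + (x \<cdot>\<^sub>m B) *\<^sub>v u \<in> carrier_vec n"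
      using B u by (intro add_carrier_vec mult_mat_vec_carrier[of _ n n]) auto
    ultimately show ?thesis by simp
  qed
  finally show ?thesis .
qed

lemma companion_eigenpair_iff:
  assumes B: "B \<in> carrier_mat n n" and C: "C \<in> carrier_mat n n" and u: "u \<in> carrier_vec n"
  shows "pencil_eigenpair (n + n) (companion_pencil n B C) (x, u @\<^sub>v x \<cdot>\<^sub>v u) \<longleftrightarrow>
    pencil_eigenpair n (quadratic_pencil n B C) (x, u)"
proof -
  have zero: "(0\<^sub>v (n + n) :: complex vec) = 0\<^sub>v n @\<^sub>v 0\<^sub>v n" by (intro eq_vecI) auto
  have "u @\<^sub>v x \<cdot>\<^sub>v u = 0\<^sub>v (n + n) \<longleftrightarrow> u = 0\<^sub>v n"
    unfolding zero append_vec_eq[OF u zero_carrier_vec] by auto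
  moreover have "(0\<^sub>v n @\<^sub>v w = 0\<^sub>v (n + n)) \<longleftrightarrow> w = 0\<^sub>v n" for w :: "complex vec"
    unfolding zero append_vec_eq[OF zero_carrier_vec zero_carrier_vec] by simp
  ultimately show ?thesis
    using u by (simp add: pencil_eigenpair_def companion_pencil_mult_stacked[OF B C u])
qed

section \<open>Matrices of stacked eigenvectors\<close>

lemma col_append_rows:
  assumes "X \<in> carrier_mat n k" "Y \<in> carrier_mat m k" "i < k"
  shows "col (X @\<^sub>r Y) i = col X i @\<^sub>v col Y i"
  using assms by (intro eq_vecI) (auto simp: append_rows_def)

lemma col_mult_mat_diag:
  fixes X :: "'a :: comm_ring_1 mat"
  assumes X: "X \<in> carrier_mat n k" and i: "i < k"
  shows "col (X * mat_diag k f) i = f i \<cdot>\<^sub>v col X i"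
  unfolding mat_diag_mult_right[OF X] using assms by (intro eq_vecI) (auto simp: ac_simps)

lemma mat_of_cols_append_four_block:
  assumes "X1 \<in> carrier_mat n k" "Y1 \<in> carrier_mat m k" "X2 \<in> carrier_mat n l" "Y2 \<in> carrier_mat m l"
  shows "mat_of_cols (n + m) (map (col (X1 @\<^sub>r Y1)) [0..<k] @ map (col (X2 @\<^sub>r Y2)) [0..<l]) =
    four_block_mat X1 X2 Y1 Y2"
  using assms
  by (intro eq_matI) (auto simp: mat_of_cols_index nth_append append_rows_def)

text \<open>
  The matrix factors as \<open>diag(V, V)\<close> times the matrix with blocks \<open>I\<close>, \<open>Q\<close> above \<open>D1\<close>, \<open>Q D2\<close>,
  and the latter has the Schur complement \<open>Q D2 - D1 Q\<close> of its identity block. Taking \<open>V\<close>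
  out first leaves an identity as pivot block, so the elimination never divides by \<open>V\<close>.
\<close>

lemma det_stacked_eigenvectors:
  fixes V Q D1 D2 :: "'a :: idom mat"
  assumes V: "V \<in> carrier_mat n n" and Q: "Q \<in> carrier_mat n n"
    and D1: "D1 \<in> carrier_mat n n" and D2: "D2 \<in> carrier_mat n n"
  shows "det (four_block_mat V (V * Q) (V * D1) (V * Q * D2)) =
    det V * det V * det (Q * D2 - D1 * Q)"
proof -
  let ?I = "1\<^sub>m n :: 'a mat" and ?O = "0\<^sub>m n n :: 'a mat"
  let ?W = "four_block_mat V ?O ?O V" and ?L = "four_block_mat ?I ?O D1 ?I"
    and ?U = "four_block_mat ?I Q ?O (Q * D2 - D1 * Q)"
  have cancel: "D1 * Q + (Q * D2 - D1 * Q) = Q * D2"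
    using Q D1 D2 by (intro eq_matI) auto
  have R: "Q * D2 - D1 * Q \<in> carrier_mat n n" using Q D1 D2 by auto
  have "?L * ?U = four_block_mat ?I Q D1 (Q * D2)"
    using Q D1 D2 R cancel by (simp add: mult_four_block_mat[of _ n n _ n _ n _ _ n _ n])
  then have "?W * (?L * ?U) = four_block_mat V (V * Q) (V * D1) (V * Q * D2)"
    using V Q D1 D2 by (simp add: mult_four_block_mat[of _ n n _ n _ n _ _ n _ n])
  then have "det (four_block_mat V (V * Q) (V * D1) (V * Q * D2)) = det ?W * (det ?L * det ?U)"
    using V Q D1 R by (metis det_mult four_block_carrier_mat mult_carrier_mat one_carrier_mat)
  also have "det ?W = det V * det V"
    using V by (simp add: det_four_block_mat_upper_right_zero[of _ n _ n])
  also have "det ?L = 1"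
    using D1 by (simp add: det_four_block_mat_upper_right_zero[of _ n _ n])
  also have "det ?U = det (Q * D2 - D1 * Q)"
    using Q R by (simp add: det_four_block_mat_lower_left_zero[of _ n _ n])
  finally show ?thesis by simp
qed

lemma det_minus_eq_0_commute:
  fixes X Y :: "'a :: idom mat"
  assumes "X \<in> carrier_mat n n" "Y \<in> carrier_mat n n"
  shows "det (X - Y) = 0 \<longleftrightarrow> det (Y - X) = 0"
proof -
  have "X - Y = (- 1) \<cdot>\<^sub>m (Y - X)" using assms by (intro eq_matI) auto
  then show ?thesis by simp
qed

section \<open>Diagonalizing the linearization\<close>


theorem theorem2:
  fixes N :: nat
    and A B C V1 Q D1 D2 :: "complex mat"
    and M S :: "complex \<Rightarrow> complex mat"
    and lam rho :: "nat \<Rightarrow> complex"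
    and M_pairs :: "(complex \<times> complex vec) list"
  assumes N: "N \<ge> 1"
    and A: "A \<in> carrier_mat N N" and B: "B \<in> carrier_mat N N" and C: "C \<in> carrier_mat N N"
    and A_inv: "invertible_mat A"
    and V1: "V1 \<in> carrier_mat N N" and Q: "Q \<in> carrier_mat N N"
    and M: "M = (\<lambda>x. four_block_mat
                       (x \<cdot>\<^sub>m 1\<^sub>m N)     (- 1\<^sub>m N)
                       (mat_inv A * C) (x \<cdot>\<^sub>m 1\<^sub>m N + mat_inv A * B))"
    and S: "S = (\<lambda>x. x^2 \<cdot>\<^sub>m 1\<^sub>m N + x \<cdot>\<^sub>m (mat_inv A * B) + mat_inv A * C)"
    and D1: "D1 = mat_diag N lam" and D2: "D2 = mat_diag N rho"
    and M_pairs: "M_pairs =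
           map (\<lambda>i. (lam i, col (V1 @\<^sub>r (V1 * D1)) i)) [0..<N] @
           map (\<lambda>i. (rho i, col ((V1 * Q) @\<^sub>r (V1 * Q * D2)) i)) [0..<N]"
  shows "((invertible_mat V1 \<and> pencil_diagonalizable_with (2 * N) M M_pairs)
          \<longleftrightarrow>
          ((\<forall>x. det (S x) = (\<Prod>i<N. x - rho i) * (\<Prod>i<N. x - lam i)) \<and>
           (\<forall>i<N. pencil_eigenpair N S (lam i, col V1 i)) \<and>
           (\<forall>i<N. pencil_eigenpair N S (rho i, col (V1 * Q) i)) \<and>
           det V1 \<noteq> 0 \<and> det (D1 * Q - Q * D2) \<noteq> 0))
         \<and>
         ((invertible_mat V1 \<and> pencil_diagonalizable_with (2 * N) M M_pairs)
          \<longrightarrow>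
          (\<forall>x. det (M x) = (\<Prod>i<N. x - rho i) * (\<Prod>i<N. x - lam i)))"
proof -
  let ?B = "mat_inv A * B" and ?C = "mat_inv A * C"
  have inv: "mat_inv A \<in> carrier_mat N N" using mat_inv_invertible(1)[OF A A_inv] .
  have B': "?B \<in> carrier_mat N N" and C': "?C \<in> carrier_mat N N" using inv B C by auto
  have M': "M = companion_pencil N ?B ?C" unfolding M companion_pencil_def ..
  have S': "S = quadratic_pencil N ?B ?C" unfolding S quadratic_pencil_def ..
  have D1': "D1 \<in> carrier_mat N N" and D2': "D2 \<in> carrier_mat N N" unfolding D1 D2 by simp_all
  have VQ: "V1 * Q \<in> carrier_mat N N" using V1 Q by simp
  have len: "length M_pairs = N + N" unfolding M_pairs by simp
  have "mat_of_cols (N + N) (map snd M_pairs) =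
      four_block_mat V1 (V1 * Q) (V1 * D1) (V1 * Q * D2)"
    unfolding M_pairs
    using mat_of_cols_append_four_block[OF V1 _ VQ, of "V1 * D1" N "V1 * Q * D2"] V1 VQ D1' D2'
    by (simp add: comp_def)
  then have det_P: "det (mat_of_cols (N + N) (map snd M_pairs)) \<noteq> 0 \<longleftrightarrow>
      det V1 \<noteq> 0 \<and> det (D1 * Q - Q * D2) \<noteq> 0"
    using det_stacked_eigenvectors[OF V1 Q D1' D2']
      det_minus_eq_0_commute[of "D1 * Q" N "Q * D2"] Q D1' D2' by simp
  have stacked: "pencil_eigenpair (N + N) M (f i, col (V @\<^sub>r (V * mat_diag N f)) i) \<longleftrightarrow>
      pencil_eigenpair N S (f i, col V i)"
    if V: "V \<in> carrier_mat N N" and i: "i < N" for V f i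
  proof -
    have "col (V @\<^sub>r (V * mat_diag N f)) i = col V i @\<^sub>v f i \<cdot>\<^sub>v col V i"
      using V i by (simp add: col_append_rows[of _ N N _ N] col_mult_mat_diag)
    moreover have "col V i \<in> carrier_vec N" using V by auto
    ultimately show ?thesis
      using companion_eigenpair_iff[OF B' C'] unfolding M' S' by simp
  qed
  have pairs: "(\<forall>p \<in> set M_pairs. pencil_eigenpair (N + N) M p) \<longleftrightarrow>
      (\<forall>i<N. pencil_eigenpair N S (lam i, col V1 i)) \<and>
      (\<forall>i<N. pencil_eigenpair N S (rho i, col (V1 * Q) i))"
    unfolding M_pairs D1 D2 using stacked[OF V1, of _ lam] stacked[OF VQ, of _ rho]
    by (auto simp: ball_Un)
  have diag_iff: "pencil_diagonalizable_with (N + N) M M_pairs \<longleftrightarrow>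
      (\<forall>i<N. pencil_eigenpair N S (lam i, col V1 i)) \<and>
      (\<forall>i<N. pencil_eigenpair N S (rho i, col (V1 * Q) i)) \<and>
      det V1 \<noteq> 0 \<and> det (D1 * Q - Q * D2) \<noteq> 0"
    using pencil_diagonalizable_with_iff_eigenbasis[of _ "N + N" M,
        OF _ companion_pencil_monic[OF B' C', folded M'] len] B' C'
    unfolding pairs det_P by auto
  have det_M: "det (M x) = (\<Prod>i<N. x - rho i) * (\<Prod>i<N. x - lam i)"
    if "pencil_diagonalizable_with (N + N) M M_pairs" for x
  proof -
    have "det (M x) = (\<Prod>i<N + N. x - fst (M_pairs ! i))"
      by (rule pencil_diagonalizable_with_det[OF that])
    also have "\<dots> = (\<Prod>i<N. x - fst (M_pairs ! i)) * (\<Prod>i<N. x - fst (M_pairs ! (N + i)))"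
      using prod.atLeastLessThan_concat[of 0 N "N + N" "\<lambda>i. x - fst (M_pairs ! i)"]
        prod.shift_bounds_nat_ivl[of "\<lambda>i. x - fst (M_pairs ! i)" 0 N N]
      by (simp add: lessThan_atLeast0 add.commute)
    also have "\<dots> = (\<Prod>i<N. x - lam i) * (\<Prod>i<N. x - rho i)"
      unfolding M_pairs by (simp add: nth_append)
    finally show ?thesis by (simp add: mult.commute)
  qed
  have det_S: "det (S x) = det (M x)" for x
    unfolding M' S' by (rule det_companion_pencil[OF B' C', symmetric])
  show ?thesis
    unfolding mult_2 invertible_mat_iff_det[OF V1] det_S using diag_iff det_M by blast
qed

end
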